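(* Let $A_1,\dots,A_{m_1}$; $B_1,\dots,B_{n_1}$; $C_1,\dots,C_{n_1'}$; $D_1,\dots,D_{m_2}$; $E_1,\dots,E_{n_2}$; $F_1,\dots,F_{n_2'}$ be positive stable matrices in $\mathbb{C}^{r\times r}$ such that, for all admissible indices $p,q$, $A_pB_q=B_qA_p$, $B_pB_q=B_qB_p$, $F_qD_p=D_pF_q$, $D_pE_q=E_qD_p$, $F_pE_q=E_qF_p$, and such that $D_p+kI$, $E_p+kI$, $F_p+kI$ are invertible for all integers $k\ge0$. Suppose that $B_i+kI$ is invertible for every $i=1,\dots,n_1$ and all integers $k\ge 0$. Let $s$ be a non-negative integer and $i\in\{1,\dots,n_1\}$. Then $$\Phi(A:B^{i},B_i+sI,C\mid D:E,F;x,y)=\Phi(A:B,C\mid D:E,F;x,y)$$ $$+\,x[A][B^{i}]\Big[\sum_{k=1}^{s}\Phi(A+I:B^{i}+I,B_i+kI,C\mid D+I:E+I,F;x,y)\Big][D]^{-1}[E]^{-1}.$$ Furthermore, if $B_i-kI$ is invertible for integers $k\le s$, then $$\Phi(A:B^{i},B_i-sI,C\mid D:E,F;x,y)=\Phi(A:B,C\mid D:E,F;x,y)$$ $$-\,x[A][B^{i}]\Big[\sum_{k=0}^{s-1}\Phi(A+I:B^{i}+I,B_i-kI,C\mid D+I:E+I,F;x,y)\Big][D]^{-1}[E]^{-1}.$$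
   Context: $I$ is the $r\times r$ identity matrix. A matrix is positive stable if all its eigenvalues have positive real part. For a square matrix $P$: $(P)_0=I$, $(P)_n=P(P+I)\cdots(P+(n-1)I)$ for $n\ge1$, and $(P)_n^{-1}$ is the inverse of $(P)_n$. For lists $A=(A_1,\dots,A_{m_1})$, $B=(B_1,\dots,B_{n_1})$, $C=(C_1,\dots,C_{n_1'})$, $D=(D_1,\dots,D_{m_2})$, $E=(E_1,\dots,E_{n_2})$, $F=(F_1,\dots,F_{n_2'})$ of $r\times r$ complex matrices, the Kampé de Fériet hypergeometric matrix function is $$\Phi(A:B,C\mid D:E,F;x,y)=\sum_{m,n\ge 0}\prod_{j=1}^{m_1}(A_j)_{m+n}\prod_{j=1}^{n_1}(B_j)_m\prod_{j=1}^{n_1'}(C_j)_n\prod_{j=1}^{m_2}(D_j)^{-1}_{m+n}\prod_{j=1}^{n_2}(E_j)^{-1}_m\prod_{j=1}^{n_2'}(F_j)^{-1}_n\,\frac{x^my^n}{m!\,n!},$$ with products in the order written and, within each product, in increasing order of the index from left to right; the same formula is used for shifted parameters whenever the inverses exist. For a list $B$: $B+kI$ means adding $kI$ to every entry; $B^{i}$ is the list with $B_i$ removed; in the argument, $B^{i},P$ (resp. $B^{i}+kI,P$) stands for the list obtained from $B$ (resp. from $B+kI$) by replacing the $i$-th entry by $P$ (the entry following it is the list $C$); $[B]=\prod_jB_j$, $[B]^{-1}=\prod_jB_j^{-1}$, $[B^{i}]=\prod_{j\ne i}B_j$. The same notation is used for the other lists. Here $x,y$ are complex numbers for which all the double series involved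 converge absolutely.
   Formalization: The formal theorem additionally assumes that the matrices A_p commute with one another, and likewise the D_p and the E_p; without this the formulas fail, e.g. for A_1=I+e_12, A_2=I+e_23, B=(I), D=(I,I), s=1, y=0, 0<x<1. *)

theory Defs
  imports "HOL-Analysis.Analysis"
begin

text \<open>
  Square complex matrices are elements of \<^typ>\<open>complex^'r^'r\<close> with CARD('r) = r. The matrix product is
  \<open>**\<close> and the identity matrix is \<^term>\<open>mat 1\<close>; the type class operations \<open>*\<close> and \<open>1\<close> on this type are
  entrywise and are not used. \<^term>\<open>mat c\<close> is c times the identity, so scaling by c is written
  \<^term>\<open>mat c ** M\<close>.
\<close>

definition positive_stable :: "complex^'r^'r \<Rightarrow> bool" where
  "positive_stable P \<longleftrightarrow> (\<forall>c v. v \<noteq> 0 \<and> P *v v = c *s v \<longrightarrow> 0 < Re c)"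

primrec mpoch :: "complex^'r^'r \<Rightarrow> nat \<Rightarrow> complex^'r^'r" where
  "mpoch P 0 = mat 1"
| "mpoch P (Suc n) = mpoch P n ** (P + mat (of_nat n))"

definition mprod :: "(complex^'r^'r) list \<Rightarrow> complex^'r^'r" where
  "mprod Ps = foldr (**) Ps (mat 1)"

definition shift :: "complex \<Rightarrow> (complex^'r^'r) list \<Rightarrow> (complex^'r^'r) list" where
  "shift c Ps = map (\<lambda>P. P + mat c) Ps"

definition remove_at :: "nat \<Rightarrow> 'a list \<Rightarrow> 'a list" where
  "remove_at i xs = take i xs @ drop (Suc i) xs"

definition kdf_term ::
  "(complex^'r^'r) list \<Rightarrow> (complex^'r^'r) list \<Rightarrow> (complex^'r^'r) list \<Rightarrow>
   (complex^'r^'r) list \<Rightarrow> (complex^'r^'r) list \<Rightarrow> (complex^'r^'r) list \<Rightarrow>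
   complex \<Rightarrow> complex \<Rightarrow> nat \<times> nat \<Rightarrow> complex^'r^'r" where
  "kdf_term A B C D E F x y = (\<lambda>(m, n).
     mat (x ^ m * y ^ n / (fact m * fact n)) **
     (mprod (map (\<lambda>P. mpoch P (m + n)) A) **
      mprod (map (\<lambda>P. mpoch P m) B) **
      mprod (map (\<lambda>P. mpoch P n) C) **
      mprod (map (\<lambda>P. matrix_inv (mpoch P (m + n))) D) **
      mprod (map (\<lambda>P. matrix_inv (mpoch P m)) E) **
      mprod (map (\<lambda>P. matrix_inv (mpoch P n)) F)))"

definition kdf ::
  "(complex^'r^'r) list \<Rightarrow> (complex^'r^'r) list \<Rightarrow> (complex^'r^'r) list \<Rightarrow>
   (complex^'r^'r) list \<Rightarrow> (complex^'r^'r) list \<Rightarrow> (complex^'r^'r) list \<Rightarrow>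
   complex \<Rightarrow> complex \<Rightarrow> complex^'r^'r" where
  "kdf A B C D E F x y = infsum (kdf_term A B C D E F x y) UNIV"

definition kdf_conv ::
  "(complex^'r^'r) list \<Rightarrow> (complex^'r^'r) list \<Rightarrow> (complex^'r^'r) list \<Rightarrow>
   (complex^'r^'r) list \<Rightarrow> (complex^'r^'r) list \<Rightarrow> (complex^'r^'r) list \<Rightarrow>
   complex \<Rightarrow> complex \<Rightarrow> bool" where
  "kdf_conv A B C D E F x y \<longleftrightarrow> (\<lambda>p. norm (kdf_term A B C D E F x y p)) summable_on UNIV"

definition commuting_lists :: "(complex^'r^'r) list \<Rightarrow> (complex^'r^'r) list \<Rightarrow> bool" where
  "commuting_lists Ps Qs \<longleftrightarrow> (\<forall>P\<in>set Ps. \<forall>Q\<in>set Qs. P ** Q = Q ** P)"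

text \<open>
  The recursion formula needs \<open>commuting_lists L L\<close> not only for L = B but also for L = A, D, E:
  pulling \<^term>\<open>mprod A\<close> out of the product of the (A_j)_(k+1) to leave the product of the (A_j + I)_k
  is false otherwise. With 3 x 3 matrix units e_pq, take A = [I + e_12, I + e_23], B = [I],
  D = [I, I], the other lists empty, s = 1, y = 0 and 0 < x < 1. All series converge absolutely,
  but the two sides of the first formula differ by the sum over k \<open>\<ge>\<close> 1 of
  (k + 1) (1/2 + ... + 1/(k + 1)) x^(k + 1) e_13.
\<close>

end

theory Submission
  imports Defs
begin

text \<open>
  The formulas rest on the contiguity relation
  \<open>(Q + I)_m - (Q)_m = m (Q + I)_(m-1)\<close> for the Pochhammer symbol. Let \<open>t(Q)\<close> be the general term of
  the series whose i-th entry in the list B is \<open>Q\<close>, and \<open>t'(Q)\<close> the one in which every entry of A, B, D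
  and E is moreover increased by I, except the i-th entry of B, which is again \<open>Q\<close>. Pulling the first
  factor out of each Pochhammer symbol, \<open>(P)_(k+1) = P (P + I)_k\<close>, and moving these factors to the
  outside by the commutation hypotheses turns the relation into
  \<open>t(Q + I)(k+1,n) - t(Q)(k+1,n) = x [A] [B^i] t'(Q + I)(k,n) [D]^-1 [E]^-1\<close>,
  while the difference vanishes at the indices \<open>(0,n)\<close> (\<open>kdf_term_update_add_one\<close>). Splitting a
  product over a list into first factors and the rest needs that the entries of the list commute with
  each other. After that \<open>[B^i]\<close> passes the factors from A, \<open>[D]^-1\<close> those from E and F, and \<open>[E]^-1\<close>
  those from F.

  Summation over all indices gives the case s = 1 (\<open>has_sum_kdf_term_update_add_one\<close>); its form with
  the subtraction is the same relation with \<open>Q + I\<close> as the starting point. The general case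
  follows by induction on s. No convergence hypothesis is needed for the intermediate series \<open>t(Q)\<close>,
  because each of them is the sum of its predecessor and a convergent series.
\<close>

section \<open>Commuting matrices\<close>

text \<open>Multiplicative commutation is a separate predicate, as the class operation \<open>*\<close> on matrices is
  entrywise.\<close>

definition commutes :: "complex^'r^'r \<Rightarrow> complex^'r^'r \<Rightarrow> bool" where
  "commutes P Q \<longleftrightarrow> P ** Q = Q ** P"

lemma commutes_sym: "commutes P Q \<Longrightarrow> commutes Q P"
  by (simp add: commutes_def)

lemma commutes_refl: "commutes P P"
  by (simp add: commutes_def)

lemma commutes_mult: "commutes P M \<Longrightarrow> commutes Q M \<Longrightarrow> commutes (P ** Q) M"
  unfolding commutes_def by (metis matrix_mul_assoc)

lemma commutes_left: "commutes P Q \<Longrightarrow> P ** (Q ** M) = Q ** (P ** M)"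
  by (simp add: commutes_def matrix_mul_assoc)

lemma matrix_add_rdistrib: "(P + Q) ** (M :: complex^'n^'m) = P ** M + Q ** M"
  by (vector matrix_matrix_mult_def sum.distrib[symmetric] distrib_right)

lemma matrix_diff_ldistrib: "(M :: complex^'n^'m) ** (P - Q) = M ** P - M ** Q"
  by (vector matrix_matrix_mult_def sum_subtractf[symmetric] right_diff_distrib)

lemma matrix_diff_rdistrib: "(P - Q) ** (M :: complex^'n^'m) = P ** M - Q ** M"
  by (vector matrix_matrix_mult_def sum_subtractf[symmetric] left_diff_distrib)

lemma mat_mult_nth: "(mat c ** (M :: complex^'r^'r)) $ a $ b = c * M $ a $ b"
  by (simp add: matrix_matrix_mult_def mat_def if_distrib if_distribR cong: if_cong)

lemma mult_mat_nth: "((M :: complex^'r^'r) ** mat c) $ a $ b = c * M $ a $ b"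
  by (simp add: matrix_matrix_mult_def mat_def if_distrib if_distribR mult.commute
      cong: if_cong)

lemma mult_mat_commute: "(M :: complex^'r^'r) ** mat c = mat c ** M"
  by (simp add: vec_eq_iff mat_mult_nth mult_mat_nth)

lemma mult_mat_left_commute: "(M :: complex^'r^'r) ** (mat c ** N) = mat c ** (M ** N)"
  by (simp only: matrix_mul_assoc mult_mat_commute[of M c])

lemma mat_mult_mat: "mat c ** (mat d :: complex^'r^'r) = mat (c * d)"
  by (simp add: vec_eq_iff mat_mult_nth) (simp add: mat_def)

lemma mat_add: "mat c + mat d = (mat (c + d) :: complex^'r^'r)"
  by (simp add: vec_eq_iff mat_def)

lemma minus_mat: "P + mat (- c) = P - (mat c :: complex^'r^'r)"
  by (simp add: vec_eq_iff mat_def)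

lemma commutes_mat: "commutes (mat c) P"
  by (simp add: commutes_def mult_mat_commute)

lemma commutes_add: "commutes P M \<Longrightarrow> commutes Q M \<Longrightarrow> commutes (P + Q) M"
  by (simp add: commutes_def matrix_add_rdistrib matrix_add_ldistrib)

lemma
  assumes "invertible (P :: complex^'r^'r)"
  shows matrix_inv_right: "P ** matrix_inv P = mat 1"
    and matrix_inv_left: "matrix_inv P ** P = mat 1"
proof -
  have "P ** matrix_inv P = mat 1 \<and> matrix_inv P ** P = mat 1"
    using assms unfolding invertible_def matrix_inv_def by (rule someI_ex)
  then show "P ** matrix_inv P = mat 1" "matrix_inv P ** P = mat 1" by auto
qed

lemma commutes_matrix_inv:
  assumes "invertible P" "commutes P M"
  shows "commutes (matrix_inv P) M"
proof -
  have "matrix_inv P ** M = matrix_inv P ** (M ** P) ** matrix_inv P"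
    by (metis assms(1) matrix_inv_right matrix_mul_assoc matrix_mul_rid)
  also have "\<dots> = matrix_inv P ** (P ** M) ** matrix_inv P"
    using assms(2) by (simp add: commutes_def)
  also have "\<dots> = M ** matrix_inv P"
    by (metis assms(1) matrix_inv_left matrix_mul_assoc matrix_mul_lid)
  finally show ?thesis by (simp add: commutes_def)
qed

lemma matrix_inv_mult:
  assumes "invertible (P :: complex^'r^'r)" "invertible (Q :: complex^'r^'r)"
  shows "matrix_inv (P ** Q) = matrix_inv Q ** matrix_inv P"
proof -
  have "(P ** Q) ** (matrix_inv Q ** matrix_inv P) = P ** (Q ** matrix_inv Q) ** matrix_inv P"
    by (simp add: matrix_mul_assoc)
  also have "\<dots> = mat 1"
    by (simp add: assms matrix_inv_right)
  finally have "(P ** Q) ** (matrix_inv Q ** matrix_inv P) = mat 1" .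
  then show ?thesis
    by (metis assms invertible_mult matrix_inv_left matrix_mul_assoc matrix_mul_lid matrix_mul_rid)
qed

section \<open>Pochhammer symbols and ordered products\<close>

lemma commutes_mpoch: "commutes P M \<Longrightarrow> commutes (mpoch P n) M"
  by (induction n) (auto intro: commutes_mult commutes_add commutes_mat)

lemma commutes_mpoch2: "commutes P Q \<Longrightarrow> commutes (mpoch P m) (mpoch Q n)"
  by (meson commutes_mpoch commutes_sym)

lemma invertible_mpoch:
  "(\<And>k::nat. invertible (P + mat (of_nat k))) \<Longrightarrow> invertible (mpoch P n)"
proof (induction n)
  case 0
  show ?case by (auto simp: invertible_def intro!: exI[of _ "mat 1"])
qed (simp add: invertible_mult)

lemma mpoch_Suc_left: "mpoch P (Suc n) = P ** mpoch (P + mat 1) n"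
proof (induction n)
  case (Suc n)
  have "mpoch P (Suc (Suc n)) = P ** mpoch (P + mat 1) n ** (P + mat (of_nat (Suc n)))"
    by (simp only: mpoch.simps(2)[of _ "Suc n"] Suc)
  also have "P + mat (of_nat (Suc n)) = P + mat 1 + mat (of_nat n)"
    by (simp add: add.assoc mat_add)
  finally show ?case
    by (simp only: mpoch.simps(2)[of "P + mat 1"] matrix_mul_assoc)
qed simp

text \<open>Contiguity relation for the Pochhammer symbol; at \<open>m = 0\<close> both symbols are the identity.\<close>

lemma mpoch_add_one_diff:
  "mpoch (Q + mat 1) (Suc n) - mpoch Q (Suc n) = mat (of_nat (Suc n)) ** mpoch (Q + mat 1) n"
proof -
  have "commutes (Q + mat 1) Q"
    by (intro commutes_add commutes_refl commutes_mat)
  then have "mpoch Q (Suc n) = mpoch (Q + mat 1) n ** Q"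
    using commutes_mpoch[of "Q + mat 1" Q n] by (simp only: mpoch_Suc_left commutes_def)
  then have "mpoch (Q + mat 1) (Suc n) - mpoch Q (Suc n)
      = mpoch (Q + mat 1) n ** (Q + mat 1 + mat (of_nat n) - Q)"
    by (simp only: mpoch.simps(2) matrix_diff_ldistrib)
  also have "Q + mat 1 + mat (of_nat n) - Q = mat (of_nat (Suc n))"
    by (simp add: add.assoc mat_add)
  finally show ?thesis by (simp add: mult_mat_commute)
qed

lemma matrix_inv_mpoch_Suc:
  assumes "\<And>k::nat. invertible (P + mat (of_nat k))"
  shows "matrix_inv (mpoch P (Suc n)) = matrix_inv (mpoch (P + mat 1) n) ** matrix_inv P"
proof -
  have "invertible (P + mat 1 + mat (of_nat k))" for k
    using assms[of "Suc k"] by (simp add: add.assoc mat_add)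
  then have "invertible (mpoch (P + mat 1) n)" by (rule invertible_mpoch)
  moreover have "invertible P" using assms[of 0] by simp
  ultimately show ?thesis by (simp only: mpoch_Suc_left matrix_inv_mult)
qed

lemma mprod_Nil [simp]: "mprod [] = mat 1"
  and mprod_Cons [simp]: "mprod (P # Ps) = P ** mprod Ps"
  by (simp_all add: mprod_def)

lemma mprod_append: "mprod (Ps @ Qs) = mprod Ps ** mprod Qs"
  by (induction Ps) (simp_all add: matrix_mul_assoc)

lemma commutes_mprod: "(\<And>P. P \<in> set Ps \<Longrightarrow> commutes P M) \<Longrightarrow> commutes (mprod Ps) M"
  by (induction Ps) (auto intro: commutes_mat commutes_mult)

lemma commutes_mprod2:
  assumes "\<And>P Q. P \<in> set Ps \<Longrightarrow> Q \<in> set Qs \<Longrightarrow> commutes P Q"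
  shows "commutes (mprod Ps) (mprod Qs)"
  by (rule commutes_mprod, rule commutes_sym, rule commutes_mprod) (auto intro: assms commutes_sym)

lemma mprod_map_mult:
  assumes "\<And>P Q. P \<in> set Ps \<Longrightarrow> Q \<in> set Ps \<Longrightarrow> commutes (g P) (f Q)"
  shows "mprod (map (\<lambda>P. f P ** g P) Ps) = mprod (map f Ps) ** mprod (map g Ps)"
  using assms
proof (induction Ps)
  case (Cons P Ps)
  have "commutes (g P) (mprod (map f Ps))"
    by (rule commutes_sym, rule commutes_mprod)
      (use Cons.prems in \<open>auto intro: commutes_sym\<close>)
  note left = commutes_left[OF this]
  have "mprod (map (\<lambda>P. f P ** g P) Ps) = mprod (map f Ps) ** mprod (map g Ps)"
    using Cons by simp
  then show ?case
    by (simp add: matrix_mul_assoc[symmetric] left)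
qed simp

text \<open>The updated entry moves to the end of the product, so that products for different new entries
  share the remaining factor.\<close>

lemma mprod_map_list_update:
  assumes "i < length Ps" "\<And>P. P \<in> set Ps \<Longrightarrow> commutes (h P) (h Q)"
  shows "mprod (map h (Ps[i := Q])) = mprod (map h (remove_at i Ps)) ** h Q"
proof -
  have "commutes (mprod (map h (drop (Suc i) Ps))) (h Q)"
    by (rule commutes_mprod) (auto intro: assms(2) dest: in_set_dropD)
  then have "h Q ** mprod (map h (drop (Suc i) Ps)) = mprod (map h (drop (Suc i) Ps)) ** h Q"
    by (simp add: commutes_def)
  then show ?thesis
    using assms(1)
    by (simp add: upd_conv_take_nth_drop remove_at_def mprod_append matrix_mul_assoc[symmetric])
qed

lemma set_remove_at_subset: "set (remove_at i xs) \<subseteq> set xs"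
  by (auto simp: remove_at_def dest: in_set_takeD in_set_dropD)

lemma remove_at_shift: "remove_at i (shift c Ps) = shift c (remove_at i Ps)"
  by (simp add: remove_at_def shift_def take_map drop_map)

lemma commuting_listsD: "commuting_lists Ps Qs \<Longrightarrow> P \<in> set Ps \<Longrightarrow> Q \<in> set Qs \<Longrightarrow> commutes P Q"
  unfolding commuting_lists_def commutes_def by blast

lemma commutes_add_mat: "commutes P Q \<Longrightarrow> commutes (P + mat c) Q"
  by (intro commutes_add commutes_mat)

lemma mprod_mpoch_Suc:
  assumes "commuting_lists Ps Ps"
  shows "mprod (map (\<lambda>P. mpoch P (Suc n)) Ps)
    = mprod Ps ** mprod (map (\<lambda>P. mpoch P n) (shift 1 Ps))"
proof -
  have "commutes (mpoch (P + mat 1) n) Q" if "P \<in> set Ps" "Q \<in> set Ps" for P Q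
    by (intro commutes_mpoch commutes_add_mat commuting_listsD[OF assms] that)
  then have "mprod (map (\<lambda>P. P ** mpoch (P + mat 1) n) Ps)
      = mprod (map (\<lambda>P. P) Ps) ** mprod (map (\<lambda>P. mpoch (P + mat 1) n) Ps)"
    by (rule mprod_map_mult)
  then show ?thesis
    by (simp add: mpoch_Suc_left shift_def comp_def del: mpoch.simps)
qed

text \<open>Inversion reverses the order, so the first factors now come out on the right.\<close>

lemma mprod_matrix_inv_mpoch_Suc:
  assumes "commuting_lists Ps Ps"
    and inv: "\<And>P k. P \<in> set Ps \<Longrightarrow> invertible (P + mat (of_nat k))"
  shows "mprod (map (\<lambda>P. matrix_inv (mpoch P (Suc n))) Ps)
    = mprod (map (\<lambda>P. matrix_inv (mpoch P n)) (shift 1 Ps)) ** mprod (map matrix_inv Ps)"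
proof -
  have inv0: "invertible P" if "P \<in> set Ps" for P
    using inv[of P 0] that by simp
  have inv1: "invertible (mpoch (P + mat 1) n)" if "P \<in> set Ps" for P
    by (rule invertible_mpoch)
      (use inv[OF that, of "Suc _"] in \<open>simp add: add.assoc mat_add\<close>)
  have "commutes (matrix_inv P) (matrix_inv (mpoch (Q + mat 1) n))"
    if "P \<in> set Ps" "Q \<in> set Ps" for P Q
    by (rule commutes_matrix_inv[OF inv0[OF that(1)] commutes_sym],
        intro commutes_matrix_inv inv1 that commutes_mpoch commutes_add_mat
        commuting_listsD[OF assms(1)])
  then have "mprod (map (\<lambda>P. matrix_inv (mpoch (P + mat 1) n) ** matrix_inv P) Ps)
      = mprod (map (\<lambda>P. matrix_inv (mpoch (P + mat 1) n)) Ps) ** mprod (map matrix_inv Ps)"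
    by (rule mprod_map_mult)
  moreover have "map (\<lambda>P. matrix_inv (mpoch P (Suc n))) Ps
      = map (\<lambda>P. matrix_inv (mpoch (P + mat 1) n) ** matrix_inv P) Ps"
    by (rule map_cong[OF refl], rule matrix_inv_mpoch_Suc) (rule inv)
  ultimately show ?thesis
    by (simp only: shift_def map_map comp_def)
qed

section \<open>Increasing one parameter by the identity\<close>

lemma mprod_mpoch_update_add_one:
  assumes "commuting_lists B B" "i < length B" "\<And>P. P \<in> set B \<Longrightarrow> commutes P Q"
  shows "mprod (map (\<lambda>P. mpoch P (Suc k)) (B[i := Q + mat 1]))
      - mprod (map (\<lambda>P. mpoch P (Suc k)) (B[i := Q]))
    = mat (of_nat (Suc k)) ** (mprod (remove_at i B)
      ** mprod (map (\<lambda>P. mpoch P k) ((shift 1 B)[i := Q + mat 1])))"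
proof -
  let ?R = "remove_at i B" and ?p = "\<lambda>k P. mpoch P k"
  have comm1: "commutes P (Q + mat 1)" if "P \<in> set B" for P
    by (rule commutes_sym, rule commutes_add_mat, rule commutes_sym, rule assms(3)[OF that])
  have "mprod (map (?p (Suc k)) (B[i := Q + mat 1])) - mprod (map (?p (Suc k)) (B[i := Q]))
      = mprod (map (?p (Suc k)) ?R) ** (mpoch (Q + mat 1) (Suc k) - mpoch Q (Suc k))"
    unfolding matrix_diff_ldistrib
    by (subst (1 2) mprod_map_list_update) (auto intro!: commutes_mpoch2 comm1 assms simp del: mpoch.simps)
  also have "mpoch (Q + mat 1) (Suc k) - mpoch Q (Suc k) = mat (of_nat (Suc k)) ** mpoch (Q + mat 1) k"
    by (rule mpoch_add_one_diff)
  also have "mprod (map (?p (Suc k)) ?R) = mprod ?R ** mprod (map (?p k) (shift 1 ?R))"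
    using assms(1) set_remove_at_subset[of i B]
    by (intro mprod_mpoch_Suc) (auto simp: commuting_lists_def)
  also have "mprod ?R ** mprod (map (?p k) (shift 1 ?R)) ** (mat (of_nat (Suc k)) ** mpoch (Q + mat 1) k)
      = mat (of_nat (Suc k)) ** (mprod ?R ** (mprod (map (?p k) (shift 1 ?R)) ** mpoch (Q + mat 1) k))"
    by (simp only: mult_mat_left_commute matrix_mul_assoc[symmetric])
  also have "mprod (map (?p k) (shift 1 ?R)) ** mpoch (Q + mat 1) k
      = mprod (map (?p k) ((shift 1 B)[i := Q + mat 1]))"
    unfolding remove_at_shift[symmetric]
    by (rule mprod_map_list_update[symmetric])
      (use assms(2) in \<open>auto simp: shift_def intro!: commutes_mpoch2[OF commutes_add_mat[OF comm1]]\<close>)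
  finally show ?thesis .
qed

lemma kdf_term_update_add_one:
  fixes A B C D E F :: "(complex^'r^'r) list"
  assumes comm_AA: "commuting_lists A A" and comm_AB: "commuting_lists A B"
    and comm_BB: "commuting_lists B B" and comm_DD: "commuting_lists D D"
    and comm_EE: "commuting_lists E E" and comm_DE: "commuting_lists D E"
    and comm_FD: "commuting_lists F D" and comm_FE: "commuting_lists F E"
    and inv: "\<And>P k. P \<in> set D \<union> set E \<union> set F \<Longrightarrow> invertible (P + mat (of_nat k))"
    and i: "i < length B" and Q: "\<And>P. P \<in> set B \<Longrightarrow> commutes P Q"
  shows "kdf_term A (B[i := Q + mat 1]) C D E F x y (m, n) - kdf_term A (B[i := Q]) C D E F x y (m, n)
    = (case m of 0 \<Rightarrow> 0 | Suc k \<Rightarrow>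
        mat x ** mprod A ** mprod (remove_at i B)
        ** kdf_term (shift 1 A) ((shift 1 B)[i := Q + mat 1]) C (shift 1 D) (shift 1 E) F x y (k, n)
        ** mprod (map matrix_inv D) ** mprod (map matrix_inv E))"
proof (cases m)
  case 0
  have "map (\<lambda>P. mpoch P 0) (B[i := Q + mat 1]) = map (\<lambda>P. mpoch P 0) (B[i := Q])"
    by (simp add: map_update)
  with 0 show ?thesis by (simp add: kdf_term_def del: mpoch.simps)
next
  case (Suc k)
  define a b d e where "a = mprod A" and "b = mprod (remove_at i B)"
    and "d = mprod (map matrix_inv D)" and "e = mprod (map matrix_inv E)"
  define a' where "a' = mprod (map (\<lambda>P. mpoch P (k + n)) (shift 1 A))"
  define b' where "b' = mprod (map (\<lambda>P. mpoch P k) ((shift 1 B)[i := Q + mat 1]))"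
  define c where "c = mprod (map (\<lambda>P. mpoch P n) C)"
  define d' where "d' = mprod (map (\<lambda>P. matrix_inv (mpoch P (k + n))) (shift 1 D))"
  define e' where "e' = mprod (map (\<lambda>P. matrix_inv (mpoch P k)) (shift 1 E))"
  define f where "f = mprod (map (\<lambda>P. matrix_inv (mpoch P n)) F)"
  define B1 B0 where "B1 = mprod (map (\<lambda>P. mpoch P m) (B[i := Q + mat 1]))"
    and "B0 = mprod (map (\<lambda>P. mpoch P m) (B[i := Q]))"
  have inv0: "invertible P" if "P \<in> set D \<union> set E" for P
    using inv[of P 0] that by auto
  have inv1: "invertible (P + mat 1 + mat (of_nat j))" if "P \<in> set D \<union> set E" for P j
    using inv[of P "Suc j"] that by (auto simp: add.assoc mat_add)
  have A: "mprod (map (\<lambda>P. mpoch P (m + n)) A) = a ** a'"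
    using mprod_mpoch_Suc[OF comm_AA, of "k + n"] by (simp add: Suc a_def a'_def del: mpoch.simps)
  have B: "B1 - B0 = mat (of_nat (Suc k)) ** (b ** b')"
    using mprod_mpoch_update_add_one[OF comm_BB i Q, of k]
    by (simp add: Suc B1_def B0_def b_def b'_def del: mpoch.simps)
  have D: "mprod (map (\<lambda>P. matrix_inv (mpoch P (m + n))) D) = d' ** d"
    using mprod_matrix_inv_mpoch_Suc[OF comm_DD, of "k + n"] inv
    by (simp add: Suc d_def d'_def del: mpoch.simps)
  have E: "mprod (map (\<lambda>P. matrix_inv (mpoch P m)) E) = e' ** e"
    using mprod_matrix_inv_mpoch_Suc[OF comm_EE, of k] inv
    by (simp add: Suc e_def e'_def del: mpoch.simps)
  have "commutes a' b"
    unfolding a'_def b_def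
    by (rule commutes_mprod2)
      (use set_remove_at_subset[of i B] in
        \<open>auto simp: shift_def intro!: commutes_mpoch commutes_add_mat commuting_listsD[OF comm_AB]\<close>)
  note ab = commutes_left[OF this]
  have "commutes d e'"
    unfolding e'_def d_def
  proof (rule commutes_sym, rule commutes_mprod2)
    fix P P' assume "P \<in> set (map (\<lambda>P. matrix_inv (mpoch P k)) (shift 1 E))"
      and "P' \<in> set (map matrix_inv D)"
    then obtain M N where "M \<in> set E" "N \<in> set D"
      and P: "P = matrix_inv (mpoch (M + mat 1) k)" "P' = matrix_inv N"
      by (auto simp: shift_def)
    have "commutes N M"
      using comm_DE \<open>M \<in> set E\<close> \<open>N \<in> set D\<close> by (auto intro: commuting_listsD)
    then have "commutes (matrix_inv N) M"
      using inv0 \<open>N \<in> set D\<close> by (intro commutes_matrix_inv) auto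
    then show "commutes P P'"
      unfolding P using inv1 \<open>M \<in> set E\<close>
      by (intro commutes_matrix_inv invertible_mpoch commutes_mpoch commutes_add_mat)
        (auto intro: commutes_sym)
  qed
  note de = commutes_left[OF this]
  have f_comm: "commutes (mprod (map matrix_inv G)) f" if "commuting_lists F G" "set G \<subseteq> set D \<union> set E" for G
    unfolding f_def
  proof (rule commutes_mprod2)
    fix P P' assume "P \<in> set (map matrix_inv G)"
      and "P' \<in> set (map (\<lambda>P. matrix_inv (mpoch P n)) F)"
    then obtain M N where "M \<in> set G" "N \<in> set F"
      and P: "P = matrix_inv M" "P' = matrix_inv (mpoch N n)"
      by auto
    have "commutes N M"
      using that(1) \<open>M \<in> set G\<close> \<open>N \<in> set F\<close> by (auto intro: commuting_listsD)
    then have "commutes P' M"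
      unfolding P using inv \<open>N \<in> set F\<close>
      by (intro commutes_matrix_inv invertible_mpoch commutes_mpoch) auto
    then show "commutes P P'"
      unfolding P(1) using inv0 that(2) \<open>M \<in> set G\<close>
      by (intro commutes_matrix_inv) (auto intro: commutes_sym)
  qed
  have "commutes d f" and "commutes e f"
    using f_comm[OF comm_FD] f_comm[OF comm_FE] by (auto simp: d_def e_def)
  then have df: "d ** (f ** e) = f ** (d ** e)" and ef: "e ** f = f ** e"
    by (auto simp: commutes_def commutes_left)
  define v w where "v = x ^ k * y ^ n / (fact k * fact n)" and "w = x ^ m * y ^ n / (fact m * fact n)"
  have scal: "of_nat (Suc k) * w = v * x"
    unfolding Suc v_def w_def by (simp add: field_simps del: of_nat_Suc)
  \<comment> \<open>\<open>W\<close> and \<open>X\<close> stay folded because \<open>mult_mat_left_commute\<close> would exchange two visible scalar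
    matrices forever.\<close>
  define W X :: "complex^'r^'r" where "W = mat w" and "X = mat x"
  define R where "R = a ** (b ** (a' ** (b' ** (c ** (d' ** (e' ** (f ** (d ** e))))))))"
  have "kdf_term A (B[i := Q + mat 1]) C D E F x y (m, n) - kdf_term A (B[i := Q]) C D E F x y (m, n)
      = W ** (a ** a' ** (B1 - B0) ** c ** (d' ** d) ** (e' ** e) ** f)"
    unfolding kdf_term_def B1_def B0_def
    by (simp add: A D E c_def f_def w_def W_def matrix_diff_ldistrib matrix_diff_rdistrib)
  also have "\<dots> = mat (of_nat (Suc k)) ** (W ** R)"
    unfolding B R_def
    by (simp only: matrix_mul_assoc[symmetric] mult_mat_left_commute ab de df ef)
  also have "\<dots> = mat v ** (X ** R)"
    by (simp only: W_def X_def matrix_mul_assoc mat_mult_mat scal)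
  also have "\<dots> = X ** a ** b ** (mat v ** (a' ** b' ** c ** d' ** e' ** f)) ** d ** e"
    unfolding R_def by (simp only: matrix_mul_assoc[symmetric] mult_mat_left_commute)
  finally show ?thesis
    unfolding Suc kdf_term_def X_def v_def a_def b_def d_def e_def a'_def b'_def c_def d'_def e'_def f_def
    by simp
qed

lemma has_sum_Suc_fst:
  fixes f :: "nat \<times> nat \<Rightarrow> 'a :: {topological_space, comm_monoid_add}"
  assumes "(f has_sum S) UNIV"
  shows "((\<lambda>(m, n). case m of 0 \<Rightarrow> 0 | Suc k \<Rightarrow> f (k, n)) has_sum S) UNIV"
proof -
  let ?g = "\<lambda>(m, n). case m of 0 \<Rightarrow> 0 | Suc k \<Rightarrow> f (k, n)" and ?h = "\<lambda>(m, n). (Suc m, n)"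
  have "(?g has_sum S) (range ?h) \<longleftrightarrow> (f has_sum S) UNIV"
    by (subst has_sum_reindex) (auto simp: inj_on_def comp_def case_prod_unfold)
  moreover have "(?g has_sum S) (range ?h) \<longleftrightarrow> (?g has_sum S) UNIV"
  proof (rule has_sum_cong_neutral)
    fix p :: "nat \<times> nat" assume "p \<in> UNIV - range ?h"
    then show "?g p = 0"
      by (cases p; cases "fst p") (auto simp: image_iff)
  qed auto
  ultimately show ?thesis using assms by simp
qed

lemma scaleR_matrix_mult: "(c *\<^sub>R M) ** N = c *\<^sub>R (M ** (N :: complex^'n^'m))"
  by (simp add: matrix_matrix_mult_def vec_eq_iff scaleR_sum_right)

lemma matrix_mult_scaleR: "M ** (c *\<^sub>R N) = c *\<^sub>R (M ** (N :: complex^'n^'m))"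
  by (simp add: matrix_matrix_mult_def vec_eq_iff scaleR_sum_right)

lemma bounded_linear_matrix_mult:
  "bounded_linear (\<lambda>M :: complex^'r^'r. P ** M ** Q ** (R :: complex^'r^'r))"
proof -
  have "linear (\<lambda>M. P ** M ** Q ** R)"
    by (rule linearI)
      (simp_all add: matrix_add_rdistrib matrix_add_ldistrib scaleR_matrix_mult matrix_mult_scaleR)
  then show ?thesis by (simp add: linear_conv_bounded_linear)
qed

lemma kdf_has_sum:
  assumes "kdf_conv A B C D E F x y"
  shows "(kdf_term A B C D E F x y has_sum kdf A B C D E F x y) UNIV"
  using assms abs_summable_summable unfolding kdf_conv_def kdf_def by (blast intro: has_sum_infsum)

text \<open>The relation of \<open>kdf_term_update_add_one\<close> after summation. It is an equivalence, so that it
  serves for raising as well as for lowering the parameter.\<close>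

lemma has_sum_kdf_term_update_add_one:
  assumes "commuting_lists A A" "commuting_lists A B" "commuting_lists B B" "commuting_lists D D"
    "commuting_lists E E" "commuting_lists D E" "commuting_lists F D" "commuting_lists F E"
    and "\<And>P k. P \<in> set D \<union> set E \<union> set F \<Longrightarrow> invertible (P + mat (of_nat k))"
    and "i < length B" "\<And>P. P \<in> set B \<Longrightarrow> commutes P Q"
    and conv: "kdf_conv (shift 1 A) ((shift 1 B)[i := Q + mat 1]) C (shift 1 D) (shift 1 E) F x y"
  shows "(kdf_term A (B[i := Q + mat 1]) C D E F x y has_sum S
      + mat x ** mprod A ** mprod (remove_at i B)
        ** kdf (shift 1 A) ((shift 1 B)[i := Q + mat 1]) C (shift 1 D) (shift 1 E) F x y
        ** mprod (map matrix_inv D) ** mprod (map matrix_inv E)) UNIV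
    \<longleftrightarrow> (kdf_term A (B[i := Q]) C D E F x y has_sum S) UNIV"
    (is "(?t1 has_sum S + ?G (kdf ?A ?B C ?D ?E F x y)) UNIV \<longleftrightarrow> (?t0 has_sum S) UNIV")
proof -
  let ?g = "\<lambda>(m, n). case m of 0 \<Rightarrow> 0 | Suc k \<Rightarrow> ?G (kdf_term ?A ?B C ?D ?E F x y (k, n))"
  have diff: "?t1 p - ?t0 p = ?g p" for p
    using kdf_term_update_add_one[OF assms(1-11), of C x y "fst p" "snd p"]
    by (simp add: case_prod_unfold)
  have g: "(?g has_sum ?G (kdf ?A ?B C ?D ?E F x y)) UNIV"
    by (rule has_sum_Suc_fst, rule has_sum_bounded_linear[OF bounded_linear_matrix_mult])
      (rule kdf_has_sum[OF conv])
  show ?thesis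
  proof
    assume "(?t0 has_sum S) UNIV"
    from has_sum_add[OF this g] show "(?t1 has_sum S + ?G (kdf ?A ?B C ?D ?E F x y)) UNIV"
      by (simp only: diff[symmetric]) simp
  next
    assume "(?t1 has_sum S + ?G (kdf ?A ?B C ?D ?E F x y)) UNIV"
    moreover have "((\<lambda>p. - ?g p) has_sum - ?G (kdf ?A ?B C ?D ?E F x y)) UNIV"
      by (subst has_sum_uminus) (simp only: minus_minus g)
    ultimately have "((\<lambda>p. ?t1 p + - ?g p) has_sum
        S + ?G (kdf ?A ?B C ?D ?E F x y) + - ?G (kdf ?A ?B C ?D ?E F x y)) UNIV"
      by (rule has_sum_add)
    then show "(?t0 has_sum S) UNIV"
      by (simp only: diff[symmetric]) simp
  qed
qed

section \<open>The recursion formulas\<close>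

theorem theorem2p3:
  fixes A B C D E F :: "(complex^'r^'r) list"
    and x y :: complex
    and s i :: nat
  assumes stable: "\<forall>P \<in> set A \<union> set B \<union> set C \<union> set D \<union> set E \<union> set F. positive_stable P"
    and comm_AB: "commuting_lists A B"
    and comm_BB: "commuting_lists B B"
    and comm_FD: "commuting_lists F D"
    and comm_DE: "commuting_lists D E"
    and comm_FE: "commuting_lists F E"
    and comm_AA: "commuting_lists A A"
    and comm_DD: "commuting_lists D D"
    and comm_EE: "commuting_lists E E"
    and inv_DEF: "\<forall>P \<in> set D \<union> set E \<union> set F. \<forall>k::nat. invertible (P + mat (of_nat k))"
    and inv_B: "\<forall>P \<in> set B. \<forall>k::nat. invertible (P + mat (of_nat k))"
    and i: "i < length B"
    and conv: "kdf_conv A B C D E F x y"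
  shows
    "(kdf_conv A (B[i := B ! i + mat (of_nat s)]) C D E F x y \<longrightarrow>
      (\<forall>k\<in>{1..s}. kdf_conv (shift 1 A) ((shift 1 B)[i := B ! i + mat (of_nat k)]) C
                            (shift 1 D) (shift 1 E) F x y) \<longrightarrow>
      kdf A (B[i := B ! i + mat (of_nat s)]) C D E F x y =
        kdf A B C D E F x y +
        mat x ** mprod A ** mprod (remove_at i B) **
        (\<Sum>k\<in>{1..s}. kdf (shift 1 A) ((shift 1 B)[i := B ! i + mat (of_nat k)]) C
                          (shift 1 D) (shift 1 E) F x y) **
        mprod (map matrix_inv D) ** mprod (map matrix_inv E))
     \<and>
     ((\<forall>k::int. k \<le> int s \<longrightarrow> invertible (B ! i - mat (of_int k))) \<longrightarrow>
      kdf_conv A (B[i := B ! i - mat (of_nat s)]) C D E F x y \<longrightarrow>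
      (\<forall>k\<in>{0..<s}. kdf_conv (shift 1 A) ((shift 1 B)[i := B ! i - mat (of_nat k)]) C
                             (shift 1 D) (shift 1 E) F x y) \<longrightarrow>
      kdf A (B[i := B ! i - mat (of_nat s)]) C D E F x y =
        kdf A B C D E F x y -
        mat x ** mprod A ** mprod (remove_at i B) **
        (\<Sum>k\<in>{0..<s}. kdf (shift 1 A) ((shift 1 B)[i := B ! i - mat (of_nat k)]) C
                           (shift 1 D) (shift 1 E) F x y) **
        mprod (map matrix_inv D) ** mprod (map matrix_inv E))"
proof -
  define G where "G = (\<lambda>M. mat x ** mprod A ** mprod (remove_at i B) ** M
    ** mprod (map matrix_inv D) ** mprod (map matrix_inv E))"
  define t where "t = (\<lambda>c. kdf_term A (B[i := B ! i + mat c]) C D E F x y)"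
  define K where "K = (\<lambda>c. kdf (shift 1 A) ((shift 1 B)[i := B ! i + mat c]) C
    (shift 1 D) (shift 1 E) F x y)"
  have lin: "linear G"
    unfolding G_def by (intro bounded_linear.linear bounded_linear_matrix_mult)
  have step: "(t (c + 1) has_sum S + G (K (c + 1))) UNIV \<longleftrightarrow> (t c has_sum S) UNIV"
    if "kdf_conv (shift 1 A) ((shift 1 B)[i := B ! i + mat (c + 1)]) C (shift 1 D) (shift 1 E) F x y"
    for c S
  proof -
    have eq: "B ! i + mat (c + 1) = B ! i + mat c + mat 1"
      by (simp add: mat_add add.assoc)
    have Q: "commutes P (B ! i + mat c)" if "P \<in> set B" for P
      by (rule commutes_sym, rule commutes_add_mat, rule commuting_listsD[OF comm_BB])
        (use i that in auto)
    show ?thesis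
      unfolding t_def K_def G_def eq
      by (rule has_sum_kdf_term_update_add_one[OF comm_AA comm_AB comm_BB comm_DD comm_EE comm_DE
            comm_FD comm_FE _ i Q that[unfolded eq]])
        (use inv_DEF in auto)
  qed
  have t0: "(t 0 has_sum kdf A B C D E F x y) UNIV"
    using kdf_has_sum[OF conv] by (simp add: t_def)

  have up: "(t (of_nat j) has_sum kdf A B C D E F x y + G (\<Sum>k\<in>{1..j}. K (of_nat k))) UNIV"
    if "\<forall>k\<in>{1..j}. kdf_conv (shift 1 A) ((shift 1 B)[i := B ! i + mat (of_nat k)]) C
          (shift 1 D) (shift 1 E) F x y" for j
    using that
  proof (induction j)
    case 0
    show ?case using t0 by (simp add: linear_0[OF lin])
  next
    case (Suc j)
    let ?S = "kdf A B C D E F x y + G (\<Sum>k\<in>{1..j}. K (of_nat k))"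
    have "(t (of_nat j) has_sum ?S) UNIV"
      using Suc by simp
    moreover have "kdf_conv (shift 1 A) ((shift 1 B)[i := B ! i + mat (of_nat j + 1)]) C
        (shift 1 D) (shift 1 E) F x y"
      using Suc.prems[rule_format, of "Suc j"] by (simp add: add.commute)
    ultimately have "(t (of_nat j + 1) has_sum ?S + G (K (of_nat j + 1))) UNIV"
      using step by blast
    then show ?case
      by (simp add: linear_add[OF lin] add.assoc add.commute[of 1])
  qed

  have down: "(t (- of_nat j) has_sum kdf A B C D E F x y - G (\<Sum>k\<in>{0..<j}. K (- of_nat k))) UNIV"
    if "\<forall>k\<in>{0..<j}. kdf_conv (shift 1 A) ((shift 1 B)[i := B ! i - mat (of_nat k)]) C
          (shift 1 D) (shift 1 E) F x y" for j
    using that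
  proof (induction j)
    case 0
    show ?case using t0 by (simp add: linear_0[OF lin])
  next
    case (Suc j)
    let ?S = "\<lambda>j. kdf A B C D E F x y - G (\<Sum>k\<in>{0..<j}. K (- of_nat k))"
    \<comment> \<open>Raising the parameter from \<open>B ! i - (j + 1) I\<close> leads to \<open>B ! i - j I\<close>.\<close>
    have shift_back: "- of_nat (Suc j) + 1 = (- of_nat j :: complex)" by simp
    have "(t (- of_nat j) has_sum ?S (Suc j) + G (K (- of_nat j))) UNIV"
      using Suc by (simp add: linear_add[OF lin])
    moreover have "kdf_conv (shift 1 A) ((shift 1 B)[i := B ! i + mat (- of_nat j)]) C
        (shift 1 D) (shift 1 E) F x y"
      using Suc.prems[rule_format, of j] by (simp add: minus_mat)
    ultimately show ?case
      using step[of "- of_nat (Suc j)" "?S (Suc j)"] unfolding shift_back by blast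
  qed

  show ?thesis
  proof (intro conjI impI, goal_cases)
    case 1
    from infsumI[OF up[OF 1(2)]] show ?case
      by (simp add: kdf_def t_def K_def G_def)
  next
    case 2
    from infsumI[OF down[OF 2(3)]] show ?case
      by (simp add: kdf_def t_def K_def G_def minus_mat)
  qed
qed

end
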